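(* Let $G=(V,E)$ be a finite, connected, undirected graph with $n := |V|\ge 2$. There exists a weighting $w : E\to\mathbb R_+$ with average leave-rate at most $1$, i.e. $\frac1n\sum_{x\in V} w(x)\le 1$, such that the continuous-time random walk on $(G,w)$ satisfies $$ \gamma_w \;\ge\; \tfrac1{16}(\operatorname{diam} G)^{-2}\qquad\text{and}\qquad \tau_w \;\le\; 8(\operatorname{diam} G)^2\log(16 n). $$
   Context: For $w:E\to\mathbb R_+$ (non-negative weights), the continuous-time random walk on $(G,w)$ jumps from $x$ to $y$ at rate $w(\{x,y\})$ for $\{x,y\}\in E$. The leave-rate of $x$ is $w(x) := \sum_{y:\{x,y\}\in E} w(\{x,y\})$. Let $L^w\in\mathbb R^{V\times V}$ be given by $L^w_{x,y} := \mathbf 1\{\{x,y\}\in E\}\,w(\{x,y\}) - \mathbf 1\{x=y\}\,w(x)$ (the generator). Its equilibrium distribution is uniform on $V$. The spectral gap $\gamma_w$ is the second smallest eigenvalue (with multiplicity) of $-L^w$. The mixing time is $\tau_w(\xi) := \inf\{t\ge0 : \max_{x,y\in V}|n\,(e^{tL^w})_{x,y}-1|\le\xi\}$ (uniform, i.e. $\ell_\infty$, distance to equilibrium), with $\tau_w := \tau_w(1/4)$. *)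

theory Defs
  imports "HOL-Analysis.Analysis" "HOL-Library.Multiset"
begin

text \<open>
  The vertex set is the universe of a finite type \<open>'v\<close>, so \<open>n = CARD('v)\<close>; the edge set consists of
  unordered pairs of distinct vertices. A weighting is a function on \<open>'v set\<close> of which only the
  values on the edge set are ever used.
\<close>

definition simple_graph :: "'v set set \<Rightarrow> bool" where
  "simple_graph E \<longleftrightarrow> (\<forall>e\<in>E. \<exists>x y. x \<noteq> y \<and> e = {x, y})"

definition adj_rel :: "'v set set \<Rightarrow> ('v \<times> 'v) set" where
  "adj_rel E = {(x, y). {x, y} \<in> E}"

definition graph_connected :: "'v set set \<Rightarrow> bool" where
  "graph_connected E \<longleftrightarrow> (\<forall>x y. (x, y) \<in> (adj_rel E)\<^sup>*)"

text \<open>The pair \<open>(x, y)\<close> lies in \<open>adj_rel E ^^ k\<close> iff there is a walk of length \<open>k\<close> from \<open>x\<close> to \<open>y\<close>.\<close>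

definition graph_dist :: "'v set set \<Rightarrow> 'v \<Rightarrow> 'v \<Rightarrow> nat" where
  "graph_dist E x y = (LEAST k. (x, y) \<in> adj_rel E ^^ k)"

definition graph_diam :: "'v::finite set set \<Rightarrow> nat" where
  "graph_diam E = (MAX (x, y)\<in>UNIV. graph_dist E x y)"

definition leave_rate :: "'v::finite set set \<Rightarrow> ('v set \<Rightarrow> real) \<Rightarrow> 'v \<Rightarrow> real" where
  "leave_rate E w x = (\<Sum>y | {x, y} \<in> E. w {x, y})"

definition generator :: "'v::finite set set \<Rightarrow> ('v set \<Rightarrow> real) \<Rightarrow> real ^ 'v ^ 'v" where
  "generator E w =
     (\<chi> x y. (if {x, y} \<in> E then w {x, y} else 0) - (if x = y then leave_rate E w x else 0))"

text \<open>
  Eigenvalues are counted with geometric multiplicity. For the symmetric matrices considered here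
  this is the same as the algebraic one, and the multiset has \<open>CARD('v)\<close> elements. The function
  passed to \<open>Abs_multiset\<close> has finite support for every matrix.
\<close>

definition eigenvalue_mset :: "real ^ 'v ^ 'v \<Rightarrow> real multiset" where
  "eigenvalue_mset A = Abs_multiset (\<lambda>\<mu>. dim {v. A *v v = \<mu> *\<^sub>R v})"

definition spectral_gap :: "'v::finite set set \<Rightarrow> ('v set \<Rightarrow> real) \<Rightarrow> real" where
  "spectral_gap E w = sorted_list_of_multiset (eigenvalue_mset (- generator E w)) ! 1"

text \<open>
  The product \<open>*\<close> on \<open>real ^ 'v ^ 'v\<close> is componentwise, so neither \<open>^\<close> nor the library's \<open>exp\<close> is
  of use for matrices.
\<close>

definition matrix_power :: "real ^ 'v ^ 'v \<Rightarrow> nat \<Rightarrow> real ^ 'v ^ 'v" where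
  "matrix_power A k = ((\<lambda>B. A ** B) ^^ k) (mat 1)"

definition matrix_exp :: "real ^ 'v ^ 'v \<Rightarrow> real ^ 'v ^ 'v" where
  "matrix_exp A = (\<Sum>k. (1 / fact k) *\<^sub>R matrix_power A k)"

text \<open>The infimum is taken in \<^typ>\<open>ereal\<close>, so that it is \<open>\<infinity>\<close> if the distance never drops to \<open>\<xi>\<close>.\<close>

definition mixing_time_at :: "'v::finite set set \<Rightarrow> ('v set \<Rightarrow> real) \<Rightarrow> real \<Rightarrow> ereal" where
  "mixing_time_at E w \<xi> =
     (INF t \<in> {t::real. 0 \<le> t \<and>
        (MAX (x, y)\<in>UNIV. \<bar>real CARD('v) * matrix_exp (t *\<^sub>R generator E w) $ x $ y - 1\<bar>) \<le> \<xi>}.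
      ereal t)"

definition mixing_time :: "'v::finite set set \<Rightarrow> ('v set \<Rightarrow> real) \<Rightarrow> ereal" where
  "mixing_time E w = mixing_time_at E w (1 / 4)"

end

theory Submission
  imports Defs
begin

text \<open>
  Let \<open>D\<close> be the diameter and fix a root \<open>r\<close>. Choose for every vertex \<open>z\<close> a shortest path from \<open>z\<close>
  to \<open>r\<close>, and let every such path deposit the weight \<open>1 / (2 D)\<close> on each edge that it traverses. A
  step contributes to the leave-rates of its two endpoints and each of the \<open>n\<close> paths has at most
  \<open>D\<close> steps, so the total leave-rate is at most \<open>2 n D / (2 D) = n\<close>
  (\<open>path_load_leave_rate\<close>).

  With these weights the Dirichlet form of \<open>f\<close> is \<open>1 / (2 D)\<close> times the sum over all paths of the
  squared increments of \<open>f\<close> along the path. By Cauchy-Schwarz the increments along the path of \<open>z\<close>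
  contribute at least \<open>(f z - f r)\<^sup>2 / D\<close>, and for \<open>f\<close> of mean zero the sum of
  \<open>(f z - f r)\<^sup>2\<close> over \<open>z\<close> is at least the squared norm of \<open>f\<close>. This is a Poincare inequality with
  constant \<open>\<gamma> = 1 / (2 D\<^sup>2)\<close> (\<open>path_load_poincare\<close>).

  The two conclusions follow from that inequality. The spectral theorem, applied to the
  generator on the vectors with coordinate sum zero, yields an orthonormal eigenbasis there, and
  the Poincare inequality says that its eigenvalues are at most \<open>-\<gamma>\<close>. The remaining direction is
  the constant vector, with eigenvalue \<open>0\<close>. Hence the spectral gap is at least \<open>\<gamma>\<close>
  (\<open>poincare_imp_spectral_gap\<close>). Expanding the exponential in this basis, the constant vector
  gives exactly the uniform distribution and everything else decays at rate \<open>\<gamma>\<close>, so that the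
  uniform distance at time \<open>t\<close> is at most \<open>n exp (-\<gamma> t)\<close>
  (\<open>poincare_imp_uniform_decay\<close>). At \<open>t = 8 D\<^sup>2 ln (16 n)\<close> this is \<open>n / (16 n)\<^sup>4\<close>, which is below
  \<open>1 / 4\<close>.
\<close>

section \<open>The spectral theorem for self-adjoint maps\<close>

text \<open>
  A minimiser \<open>v\<close> of \<open>x \<bullet> f x\<close> on the unit sphere of \<open>S\<close>, which is compact, is an eigenvector: the
  residual \<open>f v - \<mu> v\<close> lies in \<open>S\<close>, and moving \<open>v\<close> against it would lower the Rayleigh quotient
  if it were not zero.
\<close>
lemma selfadjoint_eigenvector_in_invariant_subspace:
  fixes f :: "'a::euclidean_space \<Rightarrow> 'a"
  assumes lin: "linear f" and sa: "\<And>x y. f x \<bullet> y = x \<bullet> f y"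
    and S: "subspace S" and inv: "\<And>x. x \<in> S \<Longrightarrow> f x \<in> S" and ne: "S \<noteq> {0}"
  obtains v \<mu> where "v \<in> S" "norm v = 1" "f v = \<mu> *\<^sub>R v"
proof -
  let ?K = "S \<inter> sphere 0 1"
  obtain u where u: "u \<in> S" "u \<noteq> 0"
    using ne subspace_0[OF S] by blast
  have "u /\<^sub>R norm u \<in> ?K"
    using u S by (simp add: subspace_scale)
  hence Kne: "?K \<noteq> {}" by blast
  have Kc: "compact ?K"
    using closed_subspace[OF S] by (intro closed_Int_compact) auto
  have "continuous_on ?K (\<lambda>x. x \<bullet> f x)"
    using lin by (intro continuous_intros linear_continuous_on linear_conv_bounded_linear[THEN iffD1])
  then obtain v where v: "v \<in> ?K" and vmin: "\<And>x. x \<in> ?K \<Longrightarrow> v \<bullet> f v \<le> x \<bullet> f x"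
    using continuous_attains_inf[OF Kc Kne] by blast
  define \<mu> where "\<mu> = v \<bullet> f v"
  define Q where "Q x = x \<bullet> f x - \<mu> * (x \<bullet> x)" for x
  have vS: "v \<in> S" and nv: "norm v = 1" using v by auto
  have Q_nonneg: "0 \<le> Q x" if "x \<in> S" for x
  proof (cases "x = 0")
    case True
    then show ?thesis by (simp add: Q_def)
  next
    case False
    have "\<mu> \<le> (x /\<^sub>R norm x) \<bullet> f (x /\<^sub>R norm x)"
      unfolding \<mu>_def using that False S by (intro vmin) (simp add: subspace_scale)
    also have "\<dots> = (x \<bullet> f x) / (x \<bullet> x)"
      by (simp add: linear_scale[OF lin] dot_square_norm power2_eq_square divide_inverse)
    finally show ?thesis
      using False by (simp add: Q_def field_simps)
  qed
  define r where "r = f v - \<mu> *\<^sub>R v"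
  have rS: "r \<in> S"
    unfolding r_def using vS inv S by (intro subspace_diff subspace_scale) auto
  have vv: "v \<bullet> v = 1" using nv by (simp add: dot_square_norm)
  \<comment> \<open>\<open>Q\<close> is non-negative on \<open>S\<close> and vanishes at \<open>v\<close>, so its derivative at \<open>v\<close> in direction \<open>r\<close>,
    which is \<open>2 * (r \<bullet> r)\<close>, must be \<open>0\<close>.\<close>
  have Q_line: "Q (v + s *\<^sub>R r) = 2 * s * (r \<bullet> r) + s\<^sup>2 * Q r" for s
  proof -
    have rf: "r \<bullet> f v = v \<bullet> f r" using sa[of r v] by (simp add: inner_commute)
    have rr: "r \<bullet> r = r \<bullet> f v - \<mu> * (r \<bullet> v)"
      by (subst (2) r_def) (simp add: inner_diff_right)
    have "Q (v + s *\<^sub>R r) = (v \<bullet> f v - \<mu> * (v \<bullet> v)) + 2 * s * (r \<bullet> f v - \<mu> * (r \<bullet> v)) + s\<^sup>2 * Q r"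
      using rf by (simp add: Q_def linear_add[OF lin] linear_scale[OF lin] inner_add_left
          inner_add_right inner_commute[of v r] algebra_simps power2_eq_square)
    then show ?thesis by (simp add: rr \<mu>_def vv)
  qed
  have "r \<bullet> r = 0"
  proof (rule ccontr)
    assume "r \<bullet> r \<noteq> 0"
    hence pos: "0 < r \<bullet> r" using inner_ge_zero[of r] by linarith
    have q: "0 \<le> Q r" by (rule Q_nonneg[OF rS])
    \<comment> \<open>Any negative \<open>s\<close> of modulus below \<open>2 * (r \<bullet> r) / Q r\<close> would do; the \<open>+ 1\<close> avoids a separate
      case for \<open>Q r = 0\<close>.\<close>
    define s where "s = - (r \<bullet> r) / (Q r + 1)"
    have "s < 0" unfolding s_def using pos q by (simp add: field_simps)
    have "s * Q r \<ge> - (r \<bullet> r)"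
      unfolding s_def using pos q by (simp add: field_simps)
    hence "0 < 2 * (r \<bullet> r) + s * Q r" using pos by linarith
    hence "s * (2 * (r \<bullet> r) + s * Q r) < 0" using \<open>s < 0\<close> by (simp add: mult_neg_pos)
    moreover have "0 \<le> Q (v + s *\<^sub>R r)"
      using vS rS S by (intro Q_nonneg) (simp add: subspace_add subspace_scale)
    ultimately show False by (simp add: Q_line algebra_simps power2_eq_square)
  qed
  hence "f v = \<mu> *\<^sub>R v" by (simp add: r_def)
  with vS nv show ?thesis using that by blast
qed

text \<open>
  The vectors of \<open>S\<close> orthogonal to an eigenvector form an invariant subspace of smaller dimension,
  because \<open>f\<close> is self-adjoint; induction on the dimension does the rest.
\<close>
theorem selfadjoint_orthonormal_eigenbasis:
  fixes f :: "'a::euclidean_space \<Rightarrow> 'a"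
  assumes lin: "linear f" and sa: "\<And>x y. f x \<bullet> y = x \<bullet> f y"
    and "subspace S" and "\<And>x. x \<in> S \<Longrightarrow> f x \<in> S"
  shows "\<exists>B\<subseteq>S. pairwise orthogonal B \<and> (\<forall>b\<in>B. norm b = 1 \<and> (\<exists>\<mu>. f b = \<mu> *\<^sub>R b)) \<and> span B = S"
  using assms(3,4)
proof (induction "dim S" arbitrary: S rule: less_induct)
  case less
  show ?case
  proof (cases "S = {0}")
    case True
    then show ?thesis by (intro exI[of _ "{}"]) auto
  next
    case False
    obtain v \<mu> where v: "v \<in> S" "norm v = 1" "f v = \<mu> *\<^sub>R v"
      using selfadjoint_eigenvector_in_invariant_subspace[OF lin sa less.prems(1,2) False] by blast
    have vv: "v \<bullet> v = 1" using v by (simp add: dot_square_norm)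
    define S' where "S' = {x \<in> S. v \<bullet> x = 0}"
    have sub: "subspace S'"
      using less.prems(1) unfolding S'_def subspace_def by (auto simp: inner_add_right)
    have inv: "f x \<in> S'" if "x \<in> S'" for x
      using that less.prems(2) sa[of v x] v(3) by (auto simp: S'_def)
    have "v \<notin> S'" using vv by (simp add: S'_def)
    hence "S' \<subset> S" using v(1) unfolding S'_def by blast
    hence "dim S' < dim S"
      using sub less.prems(1) by (intro dim_psubset) (simp add: span_eq_iff[THEN iffD2])
    then obtain B where B: "B \<subseteq> S'" "pairwise orthogonal B" "span B = S'"
      "\<forall>b\<in>B. norm b = 1 \<and> (\<exists>\<mu>. f b = \<mu> *\<^sub>R b)"
      using less.hyps[OF _ sub inv] by blast
    have "pairwise orthogonal (insert v B)"
      using B(1,2) by (auto simp: pairwise_insert orthogonal_def S'_def inner_commute)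
    moreover have "span (insert v B) = S"
    proof
      show "span (insert v B) \<subseteq> S"
        using v(1) B(1) less.prems(1) by (intro span_minimal) (auto simp: S'_def)
      show "S \<subseteq> span (insert v B)"
      proof
        fix x assume x: "x \<in> S"
        have "x - (v \<bullet> x) *\<^sub>R v \<in> S'"
          using x v(1) vv less.prems(1)
          by (simp add: S'_def subspace_diff subspace_scale inner_diff_right)
        then show "x \<in> span (insert v B)"
          unfolding span_insert using B(3) by blast
      qed
    qed
    ultimately show ?thesis
      using B(1,4) v by (intro exI[of _ "insert v B"]) (auto simp: S'_def)
  qed
qed

section \<open>The matrix exponential in an eigenbasis\<close>

lemma matrix_power_Suc_vector:
  "matrix_power A (Suc k) *v x = A *v (matrix_power A k *v x)"
  by (simp add: matrix_power_def matrix_vector_mul_assoc)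

lemma matrix_power_eigenvector:
  assumes "A *v b = \<mu> *\<^sub>R b"
  shows "matrix_power A k *v b = \<mu> ^ k *\<^sub>R b"
proof (induction k)
  case 0
  then show ?case by (simp add: matrix_power_def)
next
  case (Suc k)
  then show ?case
    by (simp add: matrix_power_Suc_vector matrix_vector_mult_scaleR assms mult.commute)
qed

lemma orthonormal_basis_coordinates:
  fixes B :: "(real ^ 'n) set"
  assumes "finite B" "pairwise orthogonal B" "\<And>b. b \<in> B \<Longrightarrow> norm b = 1" "span B = UNIV"
  shows "axis y 1 = (\<Sum>b\<in>B. (b $ y) *\<^sub>R b)"
  using orthonormal_basis_expand[OF assms(2) assms(3) _ assms(1), of "axis y 1"] assms(4)
  by (simp add: inner_axis')

lemma orthonormal_basis_sum_squares:
  fixes B :: "(real ^ 'n) set"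
  assumes B: "finite B" "pairwise orthogonal B" "\<And>b. b \<in> B \<Longrightarrow> norm b = 1" "span B = UNIV"
  shows "(\<Sum>b\<in>B. (b $ y)\<^sup>2) = 1"
proof -
  have "axis y 1 $ y = (\<Sum>b\<in>B. (b $ y) *\<^sub>R b) $ y"
    by (rule arg_cong[OF orthonormal_basis_coordinates[OF B]])
  then show ?thesis by (simp add: power2_eq_square)
qed

text \<open>
  In an orthonormal eigenbasis the matrix series splits, entry by entry, into finitely many scalar
  exponential series. This also settles the convergence of the series.
\<close>
lemma matrix_exp_entry_eigenbasis:
  fixes A :: "real ^ 'n ^ 'n"
  assumes B: "finite B" "pairwise orthogonal B" "\<And>b. b \<in> B \<Longrightarrow> norm b = 1" "span B = UNIV"
    and ev: "\<And>b. b \<in> B \<Longrightarrow> A *v b = \<mu> b *\<^sub>R b"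
  shows "matrix_exp A $ x $ y = (\<Sum>b\<in>B. exp (\<mu> b) * (b $ x * b $ y))"
proof -
  let ?T = "\<lambda>k. (1 / fact k) *\<^sub>R matrix_power A k"
  let ?M = "\<chi> x y. \<Sum>b\<in>B. exp (\<mu> b) * (b $ x * b $ y)"
  have power: "matrix_power A k $ x $ y = (\<Sum>b\<in>B. \<mu> b ^ k * (b $ x * b $ y))" for k x y
  proof -
    have "matrix_power A k $ x $ y = (matrix_power A k *v axis y 1) $ x"
      by (simp add: matrix_vector_mult_basis column_def)
    also have "\<dots> = (matrix_power A k *v (\<Sum>b\<in>B. b $ y *\<^sub>R b)) $ x"
      by (simp only: orthonormal_basis_coordinates[OF B, of y])
    also have "\<dots> = (\<Sum>b\<in>B. b $ y *\<^sub>R (\<mu> b ^ k *\<^sub>R b)) $ x"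
      by (simp add: linear_sum[OF matrix_vector_mul_linear] matrix_vector_mult_scaleR
          matrix_power_eigenvector[OF ev])
    finally show ?thesis by (simp add: mult_ac)
  qed
  have entry: "(\<lambda>k. ?T k $ x $ y) sums (?M $ x $ y)" for x y
  proof -
    have "(\<lambda>k. \<Sum>b\<in>B. \<mu> b ^ k /\<^sub>R fact k * (b $ x * b $ y)) sums
        (\<Sum>b\<in>B. exp (\<mu> b) * (b $ x * b $ y))"
      by (intro sums_sum sums_mult2 exp_converges)
    then show ?thesis by (simp add: power sum_distrib_left sum_divide_distrib field_simps)
  qed
  have "?T sums ?M"
    unfolding sums_def
  proof (intro vec_tendstoI)
    fix x y
    show "(\<lambda>k. sum ?T {..<k} $ x $ y) \<longlonglongrightarrow> ?M $ x $ y"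
      using entry[of x y] by (simp add: sums_def)
  qed
  then show ?thesis by (simp add: matrix_exp_def sums_unique[symmetric])
qed

section \<open>Poincare inequalities for generators\<close>

lemma generator_mult_vector:
  "(generator E w *v f) $ x = (\<Sum>y | {x, y} \<in> E. w {x, y} * (f $ y - f $ x))"
proof -
  have "(generator E w *v f) $ x =
      (\<Sum>y\<in>UNIV. (if {x, y} \<in> E then w {x, y} * f $ y else 0)
        - (if x = y then leave_rate E w x * f $ y else 0))"
    unfolding generator_def matrix_vector_mult_def
    by (auto intro!: sum.cong simp: algebra_simps)
  also have "\<dots> = (\<Sum>y | {x, y} \<in> E. w {x, y} * f $ y) - leave_rate E w x * f $ x"
    by (simp add: sum_subtractf sum.If_cases)
  finally show ?thesis
    by (simp add: leave_rate_def sum_distrib_right right_diff_distrib sum_subtractf)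
qed

lemma generator_selfadjoint:
  "(generator E w *v f) \<bullet> g = f \<bullet> (generator E w *v g)"
proof -
  have "transpose (generator E w) = generator E w"
    by (auto simp: transpose_def generator_def vec_eq_iff insert_commute)
  then show ?thesis
    by (metis dot_lmul_matrix vector_transpose_matrix)
qed

lemma generator_const: "generator E w *v (\<chi> x. c) = 0"
  by (simp add: vec_eq_iff generator_mult_vector)

lemma sum_generator_mult_vector: "(\<Sum>x\<in>UNIV. (generator E w *v f) $ x) = 0"
proof -
  have "(\<Sum>x\<in>UNIV. (generator E w *v f) $ x) = (generator E w *v f) \<bullet> (\<chi> x. 1)"
    by (simp add: inner_vec_def)
  then show ?thesis by (simp add: generator_selfadjoint generator_const)
qed

text \<open>
  Summation by parts: the right-hand side is symmetrised over the two orientations of every edge.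
\<close>
lemma dirichlet_form:
  "- (f \<bullet> (generator E w *v f)) =
     (\<Sum>x\<in>UNIV. \<Sum>y | {x, y} \<in> E. w {x, y} * (f $ x - f $ y)\<^sup>2) / 2"
proof -
  let ?h = "\<lambda>x y. if {x, y} \<in> E then w {x, y} * (f $ x * (f $ x - f $ y)) else 0"
  have cut: "(\<Sum>y | {x, y} \<in> E. k y) = (\<Sum>y\<in>UNIV. if {x, y} \<in> E then k y else 0)"
    for x and k :: "'a \<Rightarrow> real"
    by (simp add: sum.If_cases)
  have form: "- (f \<bullet> (generator E w *v f)) = (\<Sum>x\<in>UNIV. \<Sum>y\<in>UNIV. ?h x y)"
    unfolding inner_vec_def generator_mult_vector cut sum_negf[symmetric]
    by (auto simp: sum_distrib_left sum_negf[symmetric] algebra_simps intro!: sum.cong)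
  have "(\<Sum>x\<in>UNIV. \<Sum>y | {x, y} \<in> E. w {x, y} * (f $ x - f $ y)\<^sup>2)
      = (\<Sum>x\<in>UNIV. \<Sum>y\<in>UNIV. ?h x y + ?h y x)"
    unfolding cut
    by (auto simp: insert_commute algebra_simps power2_eq_square intro!: sum.cong)
  also have "\<dots> = 2 * (\<Sum>x\<in>UNIV. \<Sum>y\<in>UNIV. ?h x y)"
    using sum.swap[of ?h UNIV UNIV] by (simp add: sum.distrib)
  finally show ?thesis using form by simp
qed

text \<open>
  Both sides are stated without the factor \<open>1 / n\<close> of the uniform distribution, which cancels.
  Vectors of coordinate sum zero replace the variance of a general \<open>f\<close>.
\<close>
definition poincare_inequality :: "'v::finite set set \<Rightarrow> ('v set \<Rightarrow> real) \<Rightarrow> real \<Rightarrow> bool" where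
  "poincare_inequality E w \<gamma> \<longleftrightarrow>
     (\<forall>f. (\<Sum>x\<in>UNIV. f $ x) = 0 \<longrightarrow> \<gamma> * (f \<bullet> f) \<le> - (f \<bullet> (generator E w *v f)))"

lemma sum_eq_inner_one: "(\<Sum>x\<in>UNIV. f $ x) = (\<chi> x. 1) \<bullet> (f :: real ^ 'v)"
  by (simp add: inner_vec_def)

lemma subspace_sum_zero: "subspace {f :: real ^ 'v. (\<Sum>x\<in>UNIV. f $ x) = 0}"
  unfolding sum_eq_inner_one by (rule subspace_hyperplane)

text \<open>
  The hyperplane of vectors with coordinate sum zero is the orthogonal complement of the constants
  and is invariant under the generator, so the spectral theorem applies to it.
\<close>
lemma generator_eigenbasis_sum_zero:
  obtains B :: "(real ^ 'v::finite) set" and \<mu> where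
    "finite B" "pairwise orthogonal B" "span B = {f. (\<Sum>x\<in>UNIV. f $ x) = 0}"
    "\<And>b. b \<in> B \<Longrightarrow> norm b = 1"
    "\<And>b. b \<in> B \<Longrightarrow> generator E w *v b = \<mu> b *\<^sub>R b"
proof -
  let ?S = "{f :: real ^ 'v. (\<Sum>x\<in>UNIV. f $ x) = 0}"
  have "\<exists>B\<subseteq>?S. pairwise orthogonal B
      \<and> (\<forall>b\<in>B. norm b = 1 \<and> (\<exists>\<mu>. generator E w *v b = \<mu> *\<^sub>R b)) \<and> span B = ?S"
    by (rule selfadjoint_orthonormal_eigenbasis[OF matrix_vector_mul_linear generator_selfadjoint
        subspace_sum_zero]) (simp add: sum_generator_mult_vector)
  then obtain B where B: "pairwise orthogonal B" "span B = ?S"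
    "\<And>b. b \<in> B \<Longrightarrow> norm b = 1" "\<And>b. b \<in> B \<Longrightarrow> \<exists>\<mu>. generator E w *v b = \<mu> *\<^sub>R b"
    by metis
  obtain \<mu> where \<mu>: "\<And>b. b \<in> B \<Longrightarrow> generator E w *v b = \<mu> b *\<^sub>R b"
    using B(4) by metis
  show ?thesis
    by (rule that[OF pairwise_orthogonal_imp_finite[OF B(1)] B(1,2,3) \<mu>])
qed

lemma poincare_eigenvalue_bound:
  assumes P: "poincare_inequality E w \<gamma>" and "0 < norm b" "(\<Sum>x\<in>UNIV. b $ x) = 0"
    and "generator E w *v b = \<mu> *\<^sub>R b"
  shows "\<mu> \<le> - \<gamma>"
proof -
  have "\<gamma> * (b \<bullet> b) \<le> - \<mu> * (b \<bullet> b)"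
    using assms unfolding poincare_inequality_def by fastforce
  moreover have "0 < b \<bullet> b" using assms(2) by simp
  ultimately show ?thesis using mult_le_cancel_right_pos[of "b \<bullet> b" \<gamma> "- \<mu>"] by linarith
qed

section \<open>The spectral gap\<close>

lemma matrix_vector_mult_minus_left: "- A *v x = - (A *v (x :: real ^ 'n))"
  by (simp add: matrix_vector_mult_def vec_eq_iff sum_negf)

text \<open>
  The image of the generator has coordinate sum zero, hence so has every eigenvector with a non-zero
  eigenvalue, and the Poincare inequality can be tested on it.
\<close>
lemma poincare_eigenvector_cases:
  fixes v :: "real ^ 'v::finite"
  assumes P: "poincare_inequality E w \<gamma>" and "v \<noteq> 0"
    and ev: "- generator E w *v v = \<mu> *\<^sub>R v"
  shows "\<mu> = 0 \<or> \<gamma> \<le> \<mu>"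
proof (cases "\<mu> = 0")
  case False
  have g: "generator E w *v v = (- \<mu>) *\<^sub>R v"
    using ev by (simp add: matrix_vector_mult_minus_left minus_equation_iff)
  have "\<mu> * (\<Sum>x\<in>UNIV. v $ x) = 0"
    using sum_generator_mult_vector[of E w v] by (simp add: g sum_negf sum_distrib_left)
  hence "(\<Sum>x\<in>UNIV. v $ x) = 0" using False by simp
  then show ?thesis using poincare_eigenvalue_bound[OF P _ _ g] \<open>v \<noteq> 0\<close> by simp
qed simp

text \<open>
  Subtracting the mean from a vector in the kernel leaves a vector in the kernel of coordinate sum
  zero, which the Poincare inequality forces to vanish.
\<close>
lemma poincare_kernel:
  fixes E :: "'v::finite set set"
  assumes P: "poincare_inequality E w \<gamma>" and "0 < \<gamma>"
  shows "{v. - generator E w *v v = 0 *\<^sub>R v} = span {\<chi> x. 1}"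
proof
  show "span {\<chi> x. 1} \<subseteq> {v. - generator E w *v v = 0 *\<^sub>R v}"
    using generator_const[of E w 1]
    by (auto simp: span_singleton matrix_vector_mult_scaleR matrix_vector_mult_minus_left)
next
  show "{v. - generator E w *v v = 0 *\<^sub>R v} \<subseteq> span {\<chi> x. 1}"
  proof
    fix v :: "real ^ 'v" assume "v \<in> {v. - generator E w *v v = 0 *\<^sub>R v}"
    hence v: "generator E w *v v = 0" by (simp add: matrix_vector_mult_minus_left)
    define c where "c = (\<Sum>x\<in>UNIV. v $ x) / real CARD('v)"
    let ?u = "v - (\<chi> x. c)"
    have "(\<Sum>x\<in>UNIV. ?u $ x) = 0" by (simp add: sum_subtractf c_def)
    moreover have "generator E w *v ?u = 0"
      by (simp add: matrix_vector_mult_diff_distrib v generator_const)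
    ultimately have "\<gamma> * (?u \<bullet> ?u) \<le> 0"
      using P unfolding poincare_inequality_def by fastforce
    hence "?u \<bullet> ?u \<le> 0" using \<open>0 < \<gamma>\<close> by (simp add: mult_le_0_iff)
    hence "?u = 0" using inner_gt_zero_iff[of ?u] by linarith
    hence "v = c *\<^sub>R (\<chi> x. 1)" by (simp add: vec_eq_iff)
    then show "v \<in> span {\<chi> x. 1}" by (auto simp: span_singleton)
  qed
qed

lemma dim_pos_iff: "0 < dim S \<longleftrightarrow> (\<exists>v\<in>S. v \<noteq> 0)" for S :: "'a::euclidean_space set"
  by (auto simp: zero_less_iff_neq_zero)

text \<open>
  Eigenvectors of distinct eigenvalues are orthogonal, and a pairwise orthogonal set is finite.
  This finiteness makes \<open>eigenvalue_mset\<close> count what it is meant to count.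
\<close>
lemma finite_eigenvalues_selfadjoint:
  fixes A :: "real ^ 'n ^ 'n"
  assumes sa: "\<And>x y. (A *v x) \<bullet> y = x \<bullet> (A *v y)"
  shows "finite {\<mu>. 0 < dim {v. A *v v = \<mu> *\<^sub>R v}}"
proof -
  let ?Ev = "{\<mu>. \<exists>v. v \<noteq> 0 \<and> A *v v = \<mu> *\<^sub>R v}"
  define e where "e \<mu> = (SOME v. v \<noteq> 0 \<and> A *v v = \<mu> *\<^sub>R v)" for \<mu>
  have e: "e \<mu> \<noteq> 0 \<and> A *v e \<mu> = \<mu> *\<^sub>R e \<mu>" if "\<mu> \<in> ?Ev" for \<mu>
  proof -
    obtain v where "v \<noteq> 0 \<and> A *v v = \<mu> *\<^sub>R v" using \<open>\<mu> \<in> ?Ev\<close> by blast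
    then show ?thesis unfolding e_def by (rule someI)
  qed
  have orth_e: "orthogonal (e \<mu>) (e \<nu>)" if "\<mu> \<in> ?Ev" "\<nu> \<in> ?Ev" "\<mu> \<noteq> \<nu>" for \<mu> \<nu>
    using sa[of "e \<mu>" "e \<nu>"] e[OF that(1)] e[OF that(2)] that(3) by (simp add: orthogonal_def)
  have orth: "pairwise orthogonal (e ` ?Ev)"
  proof (rule pairwiseI)
    fix x y assume "x \<in> e ` ?Ev" "y \<in> e ` ?Ev" "x \<noteq> y"
    then obtain \<mu> \<nu> where *: "\<mu> \<in> ?Ev" "\<nu> \<in> ?Ev" "x = e \<mu>" "y = e \<nu>" by (elim imageE)
    moreover have "\<mu> \<noteq> \<nu>" using * \<open>x \<noteq> y\<close> by metis
    ultimately show "orthogonal x y" using orth_e[of \<mu> \<nu>] by simp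
  qed
  have inj: "inj_on e ?Ev"
  proof (rule inj_onI, rule ccontr)
    fix \<mu> \<nu> assume *: "\<mu> \<in> ?Ev" "\<nu> \<in> ?Ev" "e \<mu> = e \<nu>" "\<mu> \<noteq> \<nu>"
    have "orthogonal (e \<mu>) (e \<mu>)" using orth_e[OF *(1,2,4)] *(3) by simp
    then show False using e[OF *(1)] by (simp add: orthogonal_self)
  qed
  have "finite (e ` ?Ev)" using orth by (rule pairwise_orthogonal_imp_finite)
  hence "finite ?Ev" using inj by (rule finite_imageD)
  then show ?thesis by (simp add: dim_pos_iff conj_commute)
qed

text \<open>
  The eigenvalue \<open>0\<close> of the negated generator is simple and all others are at least \<open>\<gamma>\<close>, so the
  second entry of the sorted list is at least \<open>\<gamma>\<close>, provided that the list has a second entry. That is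
  guaranteed by an eigenvector of coordinate sum zero, which exists as there are two vertices.
\<close>
theorem poincare_imp_spectral_gap:
  fixes E :: "'v::finite set set"
  assumes P: "poincare_inequality E w \<gamma>" and \<gamma>: "0 < \<gamma>" and card: "2 \<le> CARD('v)"
  shows "\<gamma> \<le> spectral_gap E w"
proof -
  let ?A = "- generator E w"
  let ?M = "eigenvalue_mset ?A"
  define xs where "xs = sorted_list_of_multiset ?M"
  have "(?A *v x) \<bullet> y = x \<bullet> (?A *v y)" for x y
    by (simp add: matrix_vector_mult_minus_left generator_selfadjoint)
  hence count: "count ?M \<mu> = dim {v. ?A *v v = \<mu> *\<^sub>R v}" for \<mu>
    unfolding eigenvalue_mset_def
    by (subst count_Abs_multiset[OF finite_eigenvalues_selfadjoint]) auto
  have mset: "mset xs = ?M" by (simp add: xs_def)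
  have count0: "count ?M 0 = 1"
  proof -
    have "(\<chi> x. 1) \<noteq> (0 :: real ^ 'v)" by (simp add: vec_eq_iff)
    then show ?thesis unfolding count poincare_kernel[OF P \<gamma>] by simp
  qed
  have mem: "\<mu> = 0 \<or> \<gamma> \<le> \<mu>" if "\<mu> \<in># ?M" for \<mu>
  proof -
    have "0 < count ?M \<mu>" using that by simp
    then obtain v where "v \<noteq> 0" "?A *v v = \<mu> *\<^sub>R v"
      unfolding count dim_pos_iff by blast
    then show ?thesis by (rule poincare_eigenvector_cases[OF P])
  qed
  obtain \<mu> where \<mu>: "\<mu> \<in># ?M" "\<mu> \<noteq> 0"
  proof -
    obtain B :: "(real ^ 'v) set" and \<mu> where B: "span B = {f. (\<Sum>x\<in>UNIV. f $ x) = 0}"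
      "\<And>b. b \<in> B \<Longrightarrow> norm b = 1" "\<And>b. b \<in> B \<Longrightarrow> generator E w *v b = \<mu> b *\<^sub>R b"
      using generator_eigenbasis_sum_zero[of E w] by metis
    obtain x y :: 'v where "x \<noteq> y"
      using card by (metis card_2_iff' card_le_Suc0_iff_eq finite not_less_eq_eq numeral_2_eq_2 UNIV_I)
    have "axis x 1 - axis y (1 :: real) \<in> span B"
      unfolding B(1) by (simp add: sum_subtractf axis_def)
    moreover have "axis x 1 - axis y (1 :: real) \<noteq> 0"
      using \<open>x \<noteq> y\<close> by (simp add: axis_eq_axis)
    ultimately have "B \<noteq> {}" by auto
    then obtain b where b: "b \<in> B" by blast
    have "b \<noteq> 0" using B(2)[OF b] by auto
    have sum0: "(\<Sum>x\<in>UNIV. b $ x) = 0" using B(1) span_base[OF b] by blast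
    have le: "\<mu> b \<le> - \<gamma>"
      using \<open>b \<noteq> 0\<close> by (intro poincare_eigenvalue_bound[OF P _ sum0 B(3)[OF b]]) simp
    have "?A *v b = (- \<mu> b) *\<^sub>R b" by (simp add: matrix_vector_mult_minus_left B(3)[OF b])
    hence "0 < count ?M (- \<mu> b)" unfolding count dim_pos_iff using \<open>b \<noteq> 0\<close> by blast
    then show ?thesis using that[of "- \<mu> b"] le \<gamma> by simp
  qed
  have "0 \<in># ?M" using count0 by (metis count_eq_zero_iff zero_neq_one)
  hence two: "2 \<le> length xs"
  proof -
    have "{0, \<mu>} \<subseteq> set xs"
      using \<mu> \<open>0 \<in># ?M\<close> mset by (metis set_mset_mset insert_subset empty_subsetI)
    hence "card {0, \<mu>} \<le> card (set xs)" by (intro card_mono) auto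
    also have "\<dots> \<le> length xs" by (rule card_length)
    finally show ?thesis using \<mu> by simp
  qed
  then obtain a b ys where xs: "xs = a # b # ys"
    by (metis Suc_le_length_iff numeral_2_eq_2)
  have "a \<le> b" using sorted_sorted_list_of_multiset[of ?M] xs by (simp add: xs_def[symmetric])
  have ab: "a = 0 \<or> \<gamma> \<le> a" "b = 0 \<or> \<gamma> \<le> b"
    using mem xs mset[symmetric] by auto
  have "\<not> (a = 0 \<and> b = 0)" using count0 xs mset[symmetric] by auto
  hence "\<gamma> \<le> b" using ab \<open>a \<le> b\<close> \<gamma> by auto
  then show ?thesis by (simp add: spectral_gap_def xs_def[symmetric] xs)
qed

section \<open>The mixing time\<close>

text \<open>
  The normalised constant vector contributes \<open>1 / n\<close> to every entry of the exponential. Each of the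
  other basis vectors \<open>b\<close> contributes at most \<open>exp (- \<gamma> t) * \<bar>b $ x * b $ y\<bar>\<close>, and the
  products sum to at most \<open>1\<close>, since the squares of the \<open>x\<close>-coordinates of an orthonormal basis sum
  to \<open>1\<close>.
\<close>
theorem poincare_imp_uniform_decay:
  fixes E :: "'v::finite set set"
  assumes P: "poincare_inequality E w \<gamma>" and "0 \<le> t"
  shows "\<bar>real CARD('v) * matrix_exp (t *\<^sub>R generator E w) $ x $ y - 1\<bar>
    \<le> real CARD('v) * exp (- \<gamma> * t)"
proof -
  let ?n = "real CARD('v)"
  have n: "0 < ?n" by simp
  obtain B :: "(real ^ 'v) set" and \<mu> where B: "finite B" "pairwise orthogonal B"
    "span B = {f. (\<Sum>x\<in>UNIV. f $ x) = 0}"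
    "\<And>b. b \<in> B \<Longrightarrow> norm b = 1" "\<And>b. b \<in> B \<Longrightarrow> generator E w *v b = \<mu> b *\<^sub>R b"
    using generator_eigenbasis_sum_zero[of E w] by metis
  have sum0: "(\<Sum>x\<in>UNIV. b $ x) = 0" if "b \<in> B" for b
    using B(3) span_base[OF that] by blast
  define u :: "real ^ 'v" where "u = (\<chi> x. 1 / sqrt ?n)"
  have uu: "u \<bullet> u = 1" by (simp add: u_def inner_vec_def)
  have ub: "u \<bullet> b = 0" if "b \<in> B" for b
    using sum0[OF that] by (simp add: u_def inner_vec_def sum_divide_distrib[symmetric])
  have "u \<notin> B" using ub uu by force
  let ?C = "insert u B"
  define \<nu> where "\<nu> b = (if b = u then 0 else t * \<mu> b)" for b
  have C: "finite ?C" "pairwise orthogonal ?C" "\<And>b. b \<in> ?C \<Longrightarrow> norm b = 1" "span ?C = UNIV"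
  proof -
    show "finite ?C" using B(1) by simp
    show "pairwise orthogonal ?C"
      using B(2) ub by (auto simp: pairwise_insert orthogonal_def inner_commute)
    show "norm b = 1" if "b \<in> ?C" for b
      using that B(4) uu by (auto simp: norm_eq_1)
    show "span ?C = UNIV"
    proof (intro set_eqI iffI UNIV_I)
      fix v :: "real ^ 'v"
      have "v - ((\<Sum>x\<in>UNIV. v $ x) / sqrt ?n) *\<^sub>R u \<in> span B"
        unfolding B(3) by (simp add: u_def sum_subtractf)
      then show "v \<in> span ?C" unfolding span_insert by blast
    qed
  qed
  have ev: "(t *\<^sub>R generator E w) *v b = \<nu> b *\<^sub>R b" if "b \<in> ?C" for b
    using that B(5) \<open>u \<notin> B\<close>
    by (auto simp: \<nu>_def u_def generator_const scaleR_matrix_vector_assoc[symmetric])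
  have "matrix_exp (t *\<^sub>R generator E w) $ x $ y = (\<Sum>b\<in>?C. exp (\<nu> b) * (b $ x * b $ y))"
    by (rule matrix_exp_entry_eigenbasis[OF C ev])
  also have "\<dots> = 1 / ?n + (\<Sum>b\<in>B. exp (t * \<mu> b) * (b $ x * b $ y))"
    using B(1) \<open>u \<notin> B\<close> by (auto simp: \<nu>_def u_def intro!: sum.cong)
  finally have "?n * matrix_exp (t *\<^sub>R generator E w) $ x $ y - 1
      = ?n * (\<Sum>b\<in>B. exp (t * \<mu> b) * (b $ x * b $ y))"
    using n by (simp add: distrib_left)
  moreover have "\<bar>\<Sum>b\<in>B. exp (t * \<mu> b) * (b $ x * b $ y)\<bar> \<le> exp (- \<gamma> * t)"
  proof -
    have norm1: "(\<Sum>b\<in>B. (b $ z)\<^sup>2) \<le> 1" for z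
    proof -
      have "(\<Sum>b\<in>B. (b $ z)\<^sup>2) \<le> (\<Sum>b\<in>?C. (b $ z)\<^sup>2)"
        using B(1) by (intro sum_mono2) auto
      also have "\<dots> = 1" by (rule orthonormal_basis_sum_squares[OF C])
      finally show ?thesis by simp
    qed
    have "\<bar>\<Sum>b\<in>B. exp (t * \<mu> b) * (b $ x * b $ y)\<bar>
        \<le> (\<Sum>b\<in>B. exp (- \<gamma> * t) * (((b $ x)\<^sup>2 + (b $ y)\<^sup>2) / 2))"
    proof (rule order_trans[OF sum_abs], rule sum_mono)
      fix b assume b: "b \<in> B"
      have "\<mu> b \<le> - \<gamma>"
        by (rule poincare_eigenvalue_bound[OF P _ sum0[OF b] B(5)[OF b]]) (simp add: B(4)[OF b])
      hence "t * \<mu> b \<le> - \<gamma> * t"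
        using \<open>0 \<le> t\<close> mult_left_mono[of "\<mu> b" "- \<gamma>" t] by (simp add: mult.commute)
      moreover have "\<bar>b $ x * b $ y\<bar> \<le> ((b $ x)\<^sup>2 + (b $ y)\<^sup>2) / 2"
        using sum_squares_bound[of "\<bar>b $ x\<bar>" "\<bar>b $ y\<bar>"] by (simp add: abs_mult)
      ultimately show "\<bar>exp (t * \<mu> b) * (b $ x * b $ y)\<bar>
          \<le> exp (- \<gamma> * t) * (((b $ x)\<^sup>2 + (b $ y)\<^sup>2) / 2)"
        unfolding abs_mult[of "exp _"] abs_exp_cancel by (intro mult_mono) auto
    qed
    also have "\<dots> = exp (- \<gamma> * t) * (((\<Sum>b\<in>B. (b $ x)\<^sup>2) + (\<Sum>b\<in>B. (b $ y)\<^sup>2)) / 2)"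
      by (simp add: sum_distrib_left[symmetric] sum_divide_distrib[symmetric] sum.distrib)
    also have "\<dots> \<le> exp (- \<gamma> * t) * 1"
      using norm1[of x] norm1[of y] by (intro mult_left_mono) auto
    finally show ?thesis by simp
  qed
  ultimately show ?thesis by (simp add: abs_mult)
qed

corollary poincare_imp_mixing_time_at:
  fixes E :: "'v::finite set set"
  assumes "poincare_inequality E w \<gamma>" "0 \<le> t" "real CARD('v) * exp (- \<gamma> * t) \<le> \<xi>"
  shows "mixing_time_at E w \<xi> \<le> ereal t"
  unfolding mixing_time_at_def
proof (rule INF_lower, safe)
  show "(MAX (x, y)\<in>UNIV. \<bar>real CARD('v) * matrix_exp (t *\<^sub>R generator E w) $ x $ y - 1\<bar>) \<le> \<xi>"
    using order_trans[OF poincare_imp_uniform_decay[OF assms(1,2)] assms(3)]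
    by (subst Max_le_iff) auto
qed (use assms in auto)

section \<open>Weights from path congestion\<close>

text \<open>
  The path with index \<open>z\<close> visits \<open>P z 0, ..., P z (d z)\<close>. Traversals are counted with multiplicity,
  so that \<open>sum_path_load\<close> holds for arbitrary walks.
\<close>
definition path_load :: "('z::finite \<Rightarrow> nat \<Rightarrow> 'v) \<Rightarrow> ('z \<Rightarrow> nat) \<Rightarrow> 'v set \<Rightarrow> nat" where
  "path_load P d e = (\<Sum>z\<in>UNIV. card {i. i < d z \<and> {P z i, P z (Suc i)} = e})"

text \<open>
  Double counting. The factor \<open>2\<close> arises because the left-hand side sees every edge in both
  orientations. With \<open>g = 1\<close> this computes the total leave-rate, with \<open>g x y = (f x - f y)\<^sup>2\<close> the
  Dirichlet form.
\<close>
lemma sum_path_load: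
  fixes E :: "'v::finite set set" and g :: "'v \<Rightarrow> 'v \<Rightarrow> real"
  assumes "simple_graph E" and steps: "\<And>z i. i < d z \<Longrightarrow> {P z i, P z (Suc i)} \<in> E"
    and sym: "\<And>x y. g x y = g y x"
  shows "(\<Sum>x\<in>UNIV. \<Sum>y | {x, y} \<in> E. real (path_load P d {x, y}) * g x y)
    = 2 * (\<Sum>z\<in>UNIV. \<Sum>i<d z. g (P z i) (P z (Suc i)))"
proof -
  let ?I = "\<lambda>x y z i. if {P z i, P z (Suc i)} = {x, y} then g x y else 0"
  have load: "real (path_load P d {x, y}) * g x y = (\<Sum>z\<in>UNIV. \<Sum>i<d z. ?I x y z i)" for x y
    by (simp add: path_load_def sum_distrib_right sum.If_cases lessThan_def Collect_conj_eq[symmetric])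
  have outside: "(\<Sum>z\<in>UNIV. \<Sum>i<d z. ?I x y z i) = 0" if "{x, y} \<notin> E" for x y
    using that steps by (intro sum.neutral ballI) (metis lessThan_iff)
  have step: "(\<Sum>x\<in>UNIV. \<Sum>y\<in>UNIV. ?I x y z i) = 2 * g (P z i) (P z (Suc i))" if "i < d z" for z i
  proof -
    let ?a = "P z i" and ?b = "P z (Suc i)"
    have "?a \<noteq> ?b"
      using assms(1) steps[OF that] unfolding simple_graph_def by (metis doubleton_eq_iff)
    have "(\<Sum>x\<in>UNIV. \<Sum>y\<in>UNIV. ?I x y z i)
        = (\<Sum>p\<in>UNIV. if {?a, ?b} = {fst p, snd p} then g (fst p) (snd p) else 0)"
      by (simp add: sum.cartesian_product case_prod_unfold)
    also have "\<dots> = (\<Sum>p\<in>{(?a, ?b), (?b, ?a)}. g (fst p) (snd p))"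
      by (intro sum.mono_neutral_cong_right) (auto simp: doubleton_eq_iff)
    also have "\<dots> = 2 * g ?a ?b" using \<open>?a \<noteq> ?b\<close> sym[of ?b ?a] by simp
    finally show ?thesis .
  qed
  have "(\<Sum>x\<in>UNIV. \<Sum>y | {x, y} \<in> E. real (path_load P d {x, y}) * g x y)
      = (\<Sum>x\<in>UNIV. \<Sum>y\<in>UNIV. \<Sum>z\<in>UNIV. \<Sum>i<d z. ?I x y z i)"
    unfolding load using outside by (intro sum.cong sum.mono_neutral_left refl) auto
  also have "\<dots> = (\<Sum>x\<in>UNIV. \<Sum>z\<in>UNIV. \<Sum>i<d z. \<Sum>y\<in>UNIV. ?I x y z i)"
    by (intro sum.cong refl, subst sum.swap, intro sum.cong refl sum.swap)
  also have "\<dots> = (\<Sum>z\<in>UNIV. \<Sum>i<d z. \<Sum>x\<in>UNIV. \<Sum>y\<in>UNIV. ?I x y z i)"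
    by (subst sum.swap, intro sum.cong refl sum.swap)
  also have "\<dots> = 2 * (\<Sum>z\<in>UNIV. \<Sum>i<d z. g (P z i) (P z (Suc i)))"
    by (simp add: step sum_distrib_left)
  finally show ?thesis .
qed

lemma square_diff_le_sum_square_steps:
  fixes h :: "nat \<Rightarrow> real"
  shows "(h 0 - h k)\<^sup>2 \<le> real k * (\<Sum>i<k. (h i - h (Suc i))\<^sup>2)"
proof -
  have "(h 0 - h k)\<^sup>2 = (\<Sum>i<k. 1 * (h i - h (Suc i)))\<^sup>2"
    by (simp add: sum_lessThan_telescope')
  also have "\<dots> \<le> (\<Sum>i<k. 1\<^sup>2) * (\<Sum>i<k. (h i - h (Suc i))\<^sup>2)"
    by (rule Cauchy_Schwarz_ineq_sum)
  finally show ?thesis by simp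
qed

text \<open>
  Comparing every \<open>f z\<close> with the value at one common root is enough, since the mean minimises the sum
  of squared deviations: for mean zero, \<open>f \<bullet> f\<close> is at most the sum of \<open>(f z - f r)\<^sup>2\<close>.
\<close>
lemma path_load_poincare:
  fixes E :: "'v::finite set set"
  assumes "simple_graph E" and steps: "\<And>z i. i < d z \<Longrightarrow> {P z i, P z (Suc i)} \<in> E"
    and start: "\<And>z. P z 0 = z" and root: "\<And>z. P z (d z) = r"
    and d: "\<And>z. d z \<le> D" and D: "0 < D"
  shows "poincare_inequality E (\<lambda>e. real (path_load P d e) / (2 * real D)) (1 / (2 * (real D)\<^sup>2))"
  unfolding poincare_inequality_def
proof (intro allI impI)
  fix f :: "real ^ 'v" assume f0: "(\<Sum>x\<in>UNIV. f $ x) = 0"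
  let ?w = "\<lambda>e. real (path_load P d e) / (2 * real D)"
  let ?S = "\<Sum>z\<in>UNIV. \<Sum>i<d z. (f $ P z i - f $ P z (Suc i))\<^sup>2"
  have "- (f \<bullet> (generator E ?w *v f)) =
      (\<Sum>x\<in>UNIV. \<Sum>y | {x, y} \<in> E. real (path_load P d {x, y}) * (f $ x - f $ y)\<^sup>2) / (2 * D) / 2"
    unfolding dirichlet_form by (simp add: sum_divide_distrib)
  also have "\<dots> = ?S / (2 * D)"
    by (subst sum_path_load[where P = P and d = d, OF assms(1) steps]) (auto simp: power2_commute)
  finally have form: "- (f \<bullet> (generator E ?w *v f)) = ?S / (2 * D)" .
  have "f \<bullet> f \<le> (\<Sum>z\<in>UNIV. (f $ z - f $ r)\<^sup>2)"
  proof -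
    have "(\<Sum>z\<in>UNIV. (f $ z - f $ r)\<^sup>2)
        = (\<Sum>z\<in>UNIV. (f $ z)\<^sup>2 + (f $ r)\<^sup>2 - 2 * f $ r * f $ z)"
      by (simp add: power2_diff mult_ac)
    also have "\<dots> = f \<bullet> f + real CARD('v) * (f $ r)\<^sup>2"
      using f0 by (simp add: sum_subtractf sum.distrib sum_distrib_left[symmetric] inner_vec_def
          power2_eq_square)
    finally show ?thesis by simp
  qed
  also have "\<dots> \<le> (\<Sum>z\<in>UNIV. D * (\<Sum>i<d z. (f $ P z i - f $ P z (Suc i))\<^sup>2))"
  proof (rule sum_mono)
    fix z
    have "(f $ z - f $ r)\<^sup>2 \<le> real (d z) * (\<Sum>i<d z. (f $ P z i - f $ P z (Suc i))\<^sup>2)"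
      using square_diff_le_sum_square_steps[of "\<lambda>i. f $ P z i" "d z"] by (simp add: start root)
    also have "\<dots> \<le> D * (\<Sum>i<d z. (f $ P z i - f $ P z (Suc i))\<^sup>2)"
      using d by (intro mult_right_mono sum_nonneg) auto
    finally show "(f $ z - f $ r)\<^sup>2 \<le> D * (\<Sum>i<d z. (f $ P z i - f $ P z (Suc i))\<^sup>2)" .
  qed
  finally have "f \<bullet> f \<le> D * ?S" by (simp add: sum_distrib_left)
  then show "1 / (2 * (real D)\<^sup>2) * (f \<bullet> f) \<le> - (f \<bullet> (generator E ?w *v f))"
    unfolding form using D by (simp add: field_simps power2_eq_square)
qed

lemma path_load_leave_rate:
  fixes E :: "'v::finite set set" and P :: "'v \<Rightarrow> nat \<Rightarrow> 'v"
  assumes "simple_graph E" and steps: "\<And>z i. i < d z \<Longrightarrow> {P z i, P z (Suc i)} \<in> E"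
    and d: "\<And>z. d z \<le> D" and D: "0 < D"
  shows "(\<Sum>x\<in>UNIV. leave_rate E (\<lambda>e. real (path_load P d e) / (2 * real D)) x) \<le> real CARD('v)"
proof -
  have "(\<Sum>x\<in>UNIV. leave_rate E (\<lambda>e. real (path_load P d e) / (2 * real D)) x)
      = (\<Sum>x\<in>UNIV. \<Sum>y | {x, y} \<in> E. real (path_load P d {x, y}) * 1) / (2 * D)"
    by (simp add: leave_rate_def sum_divide_distrib)
  also have "\<dots> = (\<Sum>z\<in>UNIV. real (d z)) / D"
    by (subst sum_path_load[where P = P and d = d, OF assms(1) steps]) auto
  also have "\<dots> \<le> (\<Sum>z\<in>(UNIV :: 'v set). real D) / D"
    using d by (intro divide_right_mono sum_mono) auto
  also have "\<dots> = real CARD('v)" using D by simp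
  finally show ?thesis .
qed

section \<open>Shortest paths\<close>

lemma graph_dist_walk:
  assumes "graph_connected E"
  obtains p where "p 0 = x" "p (graph_dist E x y) = y"
    "\<And>i. i < graph_dist E x y \<Longrightarrow> {p i, p (Suc i)} \<in> E"
proof -
  have "\<exists>k. (x, y) \<in> adj_rel E ^^ k"
    using assms by (simp add: graph_connected_def rtrancl_power)
  hence "(x, y) \<in> adj_rel E ^^ graph_dist E x y"
    unfolding graph_dist_def by (rule LeastI_ex)
  then show ?thesis
    using that by (auto simp: relpow_fun_conv adj_rel_def)
qed

lemma graph_dist_le_diam: "graph_dist E x y \<le> graph_diam E"
  unfolding graph_diam_def by (rule Max_ge) (auto intro: rev_image_eqI[of "(x, y)"])

lemma graph_diam_pos:
  fixes E :: "'v::finite set set"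
  assumes "graph_connected E" and "2 \<le> CARD('v)"
  shows "0 < graph_diam E"
proof -
  obtain x y :: 'v where "x \<noteq> y"
    using assms(2) by (metis card_le_Suc0_iff_eq finite not_less_eq_eq numeral_2_eq_2 UNIV_I)
  moreover obtain p where "p 0 = x" "p (graph_dist E x y) = y"
    using graph_dist_walk[OF assms(1)] by metis
  ultimately have "graph_dist E x y \<noteq> 0" by metis
  then show ?thesis using graph_dist_le_diam[of E x y] by simp
qed

theorem theorem3:
  fixes E :: "'v::finite set set"
  assumes "simple_graph E"
    and "graph_connected E"
    and "CARD('v) \<ge> 2"
  shows "\<exists>w :: 'v set \<Rightarrow> real.
    (\<forall>e\<in>E. 0 \<le> w e) \<and>
    (1 / real CARD('v)) * (\<Sum>x\<in>UNIV. leave_rate E w x) \<le> 1 \<and>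
    spectral_gap E w \<ge> 1 / 16 * real (graph_diam E) powi (- 2) \<and>
    mixing_time E w \<le> ereal (8 * (real (graph_diam E))\<^sup>2 * ln (16 * real CARD('v)))"
proof -
  let ?n = "real CARD('v)"
  fix r :: 'v
  define D where "D = graph_diam E"
  define d where "d z = graph_dist E z r" for z
  have D: "0 < D" unfolding D_def by (rule graph_diam_pos[OF assms(2,3)])
  have d: "d z \<le> D" for z unfolding d_def D_def by (rule graph_dist_le_diam)
  have "\<forall>z. \<exists>p. p 0 = z \<and> p (d z) = r \<and> (\<forall>i<d z. {p i, p (Suc i)} \<in> E)"
    unfolding d_def using graph_dist_walk[OF assms(2)] by metis
  then obtain P where P: "\<And>z. P z 0 = z" "\<And>z. P z (d z) = r"
    "\<And>z i. i < d z \<Longrightarrow> {P z i, P z (Suc i)} \<in> E"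
    by metis
  define w where "w = (\<lambda>e. real (path_load P d e) / (2 * real D))"
  define \<gamma> where "\<gamma> = 1 / (2 * (real D)\<^sup>2)"
  have poincare: "poincare_inequality E w \<gamma>"
    unfolding w_def \<gamma>_def using path_load_poincare[OF assms(1) P(3,1,2) d D] by simp
  have \<gamma>: "0 < \<gamma>" using D by (simp add: \<gamma>_def)
  have "\<forall>e\<in>E. 0 \<le> w e" by (simp add: w_def)
  moreover have "(1 / ?n) * (\<Sum>x\<in>UNIV. leave_rate E w x) \<le> 1"
    using path_load_leave_rate[where P = P and d = d, OF assms(1) P(3) d D] by (simp add: w_def)
  moreover have "1 / 16 * real D powi (- 2) \<le> spectral_gap E w"
  proof -
    have "1 / 16 * real D powi (- 2) \<le> \<gamma>"
      using D by (simp add: \<gamma>_def power_int_minus field_simps)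
    also have "\<dots> \<le> spectral_gap E w"
      by (rule poincare_imp_spectral_gap[OF poincare \<gamma> assms(3)])
    finally show ?thesis .
  qed
  moreover have "mixing_time E w \<le> ereal (8 * (real D)\<^sup>2 * ln (16 * ?n))"
    unfolding mixing_time_def
  proof (rule poincare_imp_mixing_time_at[OF poincare])
    have n: "1 \<le> ?n" using assms(3) by simp
    have ln: "0 \<le> ln (16 * ?n)" using n by (intro ln_ge_zero) linarith
    then show "0 \<le> 8 * (real D)\<^sup>2 * ln (16 * ?n)" by simp
    have "- \<gamma> * (8 * (real D)\<^sup>2 * ln (16 * ?n)) = - 4 * ln (16 * ?n)"
      using D by (simp add: \<gamma>_def)
    also have "\<dots> \<le> - ln (16 * ?n)" using ln by linarith
    finally have "exp (- \<gamma> * (8 * (real D)\<^sup>2 * ln (16 * ?n))) \<le> inverse (16 * ?n)"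
      using n by (metis exp_le_cancel_iff exp_minus exp_ln mult_pos_pos zero_less_numeral
          less_le_trans zero_less_one)
    hence "?n * exp (- \<gamma> * (8 * (real D)\<^sup>2 * ln (16 * ?n))) \<le> ?n * inverse (16 * ?n)"
      using n by (intro mult_left_mono) auto
    also have "\<dots> \<le> 1 / 4" using n by (simp add: field_simps)
    finally show "?n * exp (- \<gamma> * (8 * (real D)\<^sup>2 * ln (16 * ?n))) \<le> 1 / 4" .
  qed
  ultimately show ?thesis unfolding D_def by blast
qed

end
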